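(* Let $R$ be a finite rod set not equivalent to the empty rod set, and let $m=\max R$. The following are equivalent: (1) the sequence $(F(n,R))_{n\ge0}$ is eventually periodic, i.e. there are $p>0$ and $N\ge0$ with $F(n+p,R)=F(n,R)$ for all $n\ge N$; (2) $(F(n,R))_{n\ge0}$ is bounded; (3) there exist $0\le a<a'$ with $F(a+j,R)=F(a'+j,R)$ for $j=0,1,\dots,m-1$; (4) there is $p>0$ with $F(n+p,R)=F(n,R)$ for all $n\ge0$; (5) the polynomial $1-C(x,R)$ divides $1-x^p$ in $\mathbb Z[x]$ for some $p\ge1$; (6) $1-C(x,R)$ equals $\pm$ a product of distinct cyclotomic polynomials; (7) there is $m'\ge1$ such that $G(x,R)=\dfrac{q(x)}{1-x^{m'}}$ with $q(x)=\sum_{k=0}^{m'-1}F(k,R)x^k$.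
   Context: A rod is a triple $(r,c,\varepsilon)$ with $r$ a positive integer (length), $c$ a tag (color), $\varepsilon\in\{\pm1\}$ (sign); antirods have sign $-1$. A rod set is a set of rods with finitely many of each length. $C(n,R)$ = (number of positive rods of length $n$) $-$ (number of antirods of length $n$); $R\equiv S$ means $C(n,R)=C(n,S)$ for all $n>0$; each class has a unique reduced member (no rod and antirod of the same length). $R$ is finite if its reduced equivalent is finite, and $\max R$ is the largest length in it. A train built from $R$ is a finite sequence of rods of $R$ (including the empty train), with length the sum of lengths and sign the product of signs; $F(n,R)$ is the number of positive trains of length $n$ minus the number of negative ones ($F(0,R)=1$). $C(x,R)=\sum_{n>0}C(n,R)x^n$ (a polynomial when $R$ is finite) and $G(x,R)=\sum_{n\ge0}F(n,R)x^n$. *)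

theory Defs
  imports Complex_Main "HOL-Computational_Algebra.Polynomial" "HOL-Computational_Algebra.Formal_Power_Series"
begin

text \<open>A rod (r, c, s): length r, colour/tag c, sign s (True = +1, False = -1, antirod).\<close>
type_synonym 'c rod = "nat \<times> 'c \<times> bool"

definition rlen :: "'c rod \<Rightarrow> nat" where "rlen \<rho> = fst \<rho>"
definition rsgn :: "'c rod \<Rightarrow> int" where "rsgn \<rho> = (if snd (snd \<rho>) then 1 else -1)"

definition rodset :: "'c rod set \<Rightarrow> bool" where
  "rodset R \<longleftrightarrow> (\<forall>\<rho>\<in>R. rlen \<rho> > 0) \<and> (\<forall>n. finite {\<rho>\<in>R. rlen \<rho> = n})"

definition Cnt :: "nat \<Rightarrow> 'c rod set \<Rightarrow> int" where
  "Cnt n R = int (card {\<rho>\<in>R. rlen \<rho> = n \<and> rsgn \<rho> = 1})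
           - int (card {\<rho>\<in>R. rlen \<rho> = n \<and> rsgn \<rho> = -1})"

definition rod_equiv :: "'c rod set \<Rightarrow> 'd rod set \<Rightarrow> bool" where
  "rod_equiv R S \<longleftrightarrow> (\<forall>n>0. Cnt n R = Cnt n S)"

text \<open>The reduced member of the class of R has exactly |C(n,R)| rods of length n, so
  R is finite iff only finitely many C(n,R) are nonzero, and max R is the largest such n.\<close>
definition rod_finite :: "'c rod set \<Rightarrow> bool" where
  "rod_finite R \<longleftrightarrow> finite {n. 0 < n \<and> Cnt n R \<noteq> 0}"

definition rod_max :: "'c rod set \<Rightarrow> nat" where
  "rod_max R = Max {n. 0 < n \<and> Cnt n R \<noteq> 0}"

definition trains :: "nat \<Rightarrow> 'c rod set \<Rightarrow> 'c rod list set" where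
  "trains n R = {xs. set xs \<subseteq> R \<and> sum_list (map rlen xs) = n}"

definition Ftr :: "nat \<Rightarrow> 'c rod set \<Rightarrow> int" where
  "Ftr n R = (\<Sum>xs\<in>trains n R. prod_list (map rsgn xs))"

definition Cpoly :: "'c rod set \<Rightarrow> int poly" where
  "Cpoly R = (\<Sum>n\<in>{n. 0 < n \<and> Cnt n R \<noteq> 0}. monom (Cnt n R) n)"

text \<open>G(x,R) as a formal power series (over the rationals, so that division is available).\<close>
definition Gfps :: "'c rod set \<Rightarrow> rat fps" where
  "Gfps R = Abs_fps (\<lambda>n. of_int (Ftr n R))"

definition cyclotomic :: "nat \<Rightarrow> int poly" where
  "cyclotomic n = (THE p. map_poly of_int p =
      (\<Prod>k\<in>{k. k < n \<and> coprime k n}. [:- cis (2 * pi * real k / real n), 1:]))"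

end

(* The recurrence F(n) = sum_k C(k) F(n-k), obtained by removing the first rod of a train, has
   order m and an invertible last coefficient over the rationals: a window of m consecutive values
   determines the sequence in both directions. With the pigeonhole principle this makes (1)-(4)
   equivalent, and G * (1 - C) = 1 turns periodicity into (5) and (7).

   For (5) ==> (6) it suffices that the roots of an integer divisor g of x^n - 1 = g h are closed
   under z |-> z^q for each prime q not dividing n. If g(z) = 0 but g(z^q) /= 0, then h(z^q) = 0, so
   differentiating at z^q gives n = z^q g(z^q) h'(z^q). As g(z^q) is congruent to g(z)^q = 0 modulo
   q, the rational number n/q is an integer polynomial in z, hence an algebraic integer, so q
   divides n. *)

theory Submission
  imports "Jordan_Normal_Form.Char_Poly" Defs "HOL-Number_Theory.Cong"
    "HOL-Computational_Algebra.Fundamental_Theorem_Algebra"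
    "HOL-Computational_Algebra.Polynomial_FPS"
begin

(* HOL-Algebra's module.smult would capture the polynomial smult of the theorem. *)
hide_const (open) module.smult

section \<open>Trains: splitting off the first rod\<close>

section \<open>Trains\<close>

lemma trains_0: "rodset R \<Longrightarrow> trains 0 R = {[]}"
proof -
  assume "rodset R"
  then have "xs = []" if "xs \<in> trains 0 R" for xs
    using that by (cases xs) (auto simp: trains_def rodset_def)
  then show ?thesis by (auto simp: trains_def)
qed

text \<open>A nonempty train is its first rod, of length \<open>k\<close>, followed by a train of
  length \<open>Suc n - k\<close>. Rods have positive length, so that rest is strictly shorter and
  strong induction applies.\<close>

lemma trains_Suc:
  assumes "rodset R"
  shows "trains (Suc n) R =
    (\<Union>k\<in>{1..Suc n}. (\<lambda>(\<rho>, xs). \<rho> # xs) ` ({\<rho>\<in>R. rlen \<rho> = k} \<times> trains (Suc n - k) R))"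
    (is "?A = ?B")
proof
  show "?A \<subseteq> ?B"
  proof
    fix xs assume xs: "xs \<in> ?A"
    then obtain \<rho> ys where [simp]: "xs = \<rho> # ys"
      by (cases xs) (auto simp: trains_def)
    have "\<rho> \<in> R" "set ys \<subseteq> R" "rlen \<rho> + sum_list (map rlen ys) = Suc n"
      using xs by (auto simp: trains_def)
    moreover have "rlen \<rho> > 0" using assms \<open>\<rho> \<in> R\<close> by (auto simp: rodset_def)
    ultimately show "xs \<in> ?B"
      by (auto simp: trains_def image_iff intro!: bexI[of _ "rlen \<rho>"])
  qed
  show "?B \<subseteq> ?A" by (auto simp: trains_def)
qed

text \<open>\<open>Ftr\<close> sums over this set, and a sum over an infinite set would default to
  0. Each length offers finitely many first rods.\<close>

lemma finite_trains:
  assumes "rodset R"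
  shows "finite (trains n R)"
proof (induction n rule: less_induct)
  case (less n)
  show ?case
  proof (cases n)
    case 0
    then show ?thesis using trains_0[OF assms] by simp
  next
    case (Suc l)
    have "finite ({\<rho>\<in>R. rlen \<rho> = k} \<times> trains (Suc l - k) R)" if "k \<in> {1..Suc l}" for k
      using less[of "Suc l - k"] that assms Suc by (auto simp: rodset_def)
    then show ?thesis unfolding Suc trains_Suc[OF assms] by blast
  qed
qed

lemma sum_rsgn:
  assumes "rodset R"
  shows "(\<Sum>\<rho>\<in>{\<rho>\<in>R. rlen \<rho> = k}. rsgn \<rho>) = Cnt k R"
proof -
  have fin: "finite {\<rho>\<in>R. rlen \<rho> = k}" using assms by (simp add: rodset_def)
  have "(\<Sum>\<rho>\<in>{\<rho>\<in>R. rlen \<rho> = k}. rsgn \<rho>)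
      = (\<Sum>\<rho>\<in>{\<rho>\<in>R. rlen \<rho> = k \<and> rsgn \<rho> = 1} \<union> {\<rho>\<in>R. rlen \<rho> = k \<and> rsgn \<rho> = -1}. rsgn \<rho>)"
    by (rule sum.cong) (auto simp: rsgn_def split: if_splits)
  also have "\<dots> = (\<Sum>\<rho>\<in>{\<rho>\<in>R. rlen \<rho> = k \<and> rsgn \<rho> = 1}. rsgn \<rho>)
      + (\<Sum>\<rho>\<in>{\<rho>\<in>R. rlen \<rho> = k \<and> rsgn \<rho> = -1}. rsgn \<rho>)"
    by (rule sum.union_disjoint) (auto intro: finite_subset[OF _ fin])
  finally show ?thesis by (simp add: Cnt_def)
qed

lemma Ftr_0: "rodset R \<Longrightarrow> Ftr 0 R = 1"
  by (simp add: Ftr_def trains_0)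

text \<open>Signs multiply along a train, so for a fixed length \<open>k\<close> of the first rod
  the signed count factors into the signed count of first rods and that of the remaining
  trains.\<close>

lemma Ftr_Suc:
  assumes "rodset R"
  shows "Ftr (Suc n) R = (\<Sum>k\<in>{1..Suc n}. Cnt k R * Ftr (Suc n - k) R)"
proof -
  let ?T = "\<lambda>k. {\<rho>\<in>R. rlen \<rho> = k} \<times> trains (Suc n - k) R"
  let ?c = "\<lambda>(\<rho> :: 'a rod, xs). \<rho> # xs"
  have fin: "finite (?T k)" for k
    using assms finite_trains[OF assms] by (simp add: rodset_def)
  have "Ftr (Suc n) R = (\<Sum>k\<in>{1..Suc n}. \<Sum>xs\<in>?c ` ?T k. prod_list (map rsgn xs))"
    unfolding Ftr_def trains_Suc[OF assms] using fin
    \<comment> \<open>The pieces are disjoint because \<open>k\<close> is the length of the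
      head.\<close>
    by (intro sum.UNION_disjoint) auto
  also have "\<dots> = (\<Sum>k\<in>{1..Suc n}. \<Sum>(\<rho>, xs)\<in>?T k. rsgn \<rho> * prod_list (map rsgn xs))"
    by (intro sum.cong refl, subst sum.reindex) (auto simp: inj_on_def case_prod_unfold)
  also have "\<dots> = (\<Sum>k\<in>{1..Suc n}. Cnt k R * Ftr (Suc n - k) R)"
    by (simp add: Ftr_def sum_rsgn[OF assms, symmetric] sum_product sum.cartesian_product)
  finally show ?thesis .
qed

section \<open>Integer sequences with a linear recurrence of order m\<close>

section \<open>Linear recurrences\<close>

text \<open>The condition \<open>n \<ge> m\<close> keeps every \<open>n - k\<close> free of
  truncation, and \<open>c m \<noteq> 0\<close> makes the recurrence of exact order
  \<open>m\<close>, so that it can also be solved backwards.\<close>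

locale linear_recurrence =
  fixes F c :: "nat \<Rightarrow> int" and m :: nat
  assumes m_pos: "m > 0" and c_m: "c m \<noteq> 0"
    and rec: "n \<ge> m \<Longrightarrow> F n = (\<Sum>k=1..m. c k * F (n - k))"
begin

lemma window_determines_future:
  assumes "\<And>j. j < m \<Longrightarrow> F (a + j) = F (b + j)"
  shows "F (a + j) = F (b + j)"
proof (induction j rule: less_induct)
  case (less j)
  show ?case
  proof (cases "j < m")
    case True
    then show ?thesis using assms by simp
  next
    case False
    have "F (a + j - k) = F (b + j - k)" if "k \<in> {1..m}" for k
      using less[of "j - k"] that False by simp
    then show ?thesis using False by (simp add: rec)
  qed
qed

text \<open>The threshold \<open>N\<close> is lowered to 0 one step at a time: the recurrence for
  the term with index \<open>M + m\<close> determines \<open>F M\<close>, because \<open>c m\<close>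
  can be cancelled.\<close>

lemma purely_periodic:
  assumes "\<And>n. n \<ge> N \<Longrightarrow> F (n + p) = F n"
  shows "F (n + p) = F n"
proof -
  have "\<forall>n\<ge>M. F (n + p) = F n" if "M \<le> N" for M
    using that
  proof (induction M rule: inc_induct)
    case base
    then show ?case using assms by simp
  next
    case (step M)
    have "F (M + p) = F M"
    proof -
      \<comment> \<open>Isolates the summand \<open>k = m\<close>, the only one that reaches back to
        index \<open>i\<close>.\<close>
      have split: "F (i + m) = (\<Sum>k=1..<m. c k * F (i + m - k)) + c m * F i" for i
      proof -
        have "{1..m} = insert m {1..<m}" using m_pos by auto
        then show ?thesis by (simp add: rec[of "i + m"])
      qed
      have "F (M + p + m) = F (M + m)"
        using step.IH[rule_format, of "M + m"] m_pos by (simp add: ac_simps)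
      moreover have "F (M + p + m - k) = F (M + m - k)" if "k \<in> {1..<m}" for k
      proof -
        have "M + p + m - k = (M + m - k) + p" "M + m - k \<ge> Suc M" using that by auto
        then show ?thesis using step.IH[rule_format, of "M + m - k"] by simp
      qed
      ultimately have "c m * F (M + p) = c m * F M"
        using split[of "M + p"] split[of M] by simp
      then show ?thesis using c_m by simp
    qed
    then show ?case using step.IH by (metis not_less_eq_eq le_antisym)
  qed
  from this[of 0] show ?thesis by simp
qed

text \<open>Pigeonhole: a window is a list of \<open>m\<close> integers between \<open>-B\<close>
  and \<open>B\<close>, and there are finitely many such lists.\<close>

lemma bounded_imp_equal_windows:
  assumes "\<And>n. \<bar>F n\<bar> \<le> B"
  shows "\<exists>a b. a < b \<and> (\<forall>j<m. F (a + j) = F (b + j))"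
proof -
  let ?w = "\<lambda>n. map (\<lambda>j. F (n + j)) [0..<m]"
  have "range ?w \<subseteq> {xs. set xs \<subseteq> {-B..B} \<and> length xs = m}"
    using assms by (auto simp: abs_le_iff minus_le_iff)
  then have "finite (range ?w)"
    by (rule finite_subset) (rule finite_lists_length_eq, simp)
  then have "\<not> inj ?w" using finite_imageD infinite_UNIV_nat by blast
  then obtain a b where "a \<noteq> b" and "?w a = ?w b" by (auto simp: inj_def)
  then have "\<forall>j<m. F (a + j) = F (b + j)" by simp
  with \<open>a \<noteq> b\<close> show ?thesis by (metis linorder_neqE_nat)
qed

end

lemma eventually_periodic_imp_bounded:
  fixes F :: "nat \<Rightarrow> int"
  assumes "p > 0" and "\<And>n. n \<ge> N \<Longrightarrow> F (n + p) = F n"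
  shows "\<exists>B. \<forall>n. \<bar>F n\<bar> \<le> B"
proof -
  define B where "B = Max ((\<lambda>n. \<bar>F n\<bar>) ` {..N + p})"
  have "\<bar>F n\<bar> \<le> B" for n
  proof (induction n rule: less_induct)
    case (less n)
    show ?case
    proof (cases "n \<le> N + p")
      case True
      then show ?thesis unfolding B_def by (intro Max_ge) auto
    next
      case False
      then show ?thesis using less[of "n - p"] assms(1) assms(2)[of "n - p"] by simp
    qed
  qed
  then show ?thesis by blast
qed

section \<open>Orders of roots of unity and the factorization of X^n - 1\<close>

section \<open>Roots of unity and cyclotomic polynomials\<close>

lemma power_mod_of_root_of_unity:
  fixes z :: "'a :: monoid_mult"
  assumes "z ^ d = 1"
  shows "z ^ (e mod d) = z ^ e"
proof -
  have "z ^ (d * (e div d) + e mod d) = z ^ (e mod d)"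
    unfolding power_add power_mult assms by simp
  then show ?thesis by simp
qed

text \<open>The root set behind \<open>cyclotomic\<close>. The index \<open>k = 0\<close> occurs
  only for \<open>n = 1\<close>, where it contributes the root 1.\<close>

definition primitive_roots :: "nat \<Rightarrow> complex set" where
  "primitive_roots n = (\<lambda>k. cis (2 * pi * real k / real n)) ` {k. k < n \<and> coprime k n}"

lemma inj_on_cis_div: "n > 0 \<Longrightarrow> inj_on (\<lambda>k. cis (2 * pi * real k / real n)) {..<n}"
  using bij_betw_roots_unity[of n] by (simp add: bij_betw_def)

lemma cis_div_mod:
  assumes "n > 0"
  shows "cis (2 * pi * real (j mod n) / real n) = cis (2 * pi * real j / real n)"
proof -
  have "real j / real n = real (j div n) + real (j mod n) / real n"
    using assms by (simp add: real_of_nat_div field_simps flip: of_nat_mult of_nat_add)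
  then have "2 * pi * real j / real n = 2 * pi * real (j div n) + 2 * pi * real (j mod n) / real n"
    by (metis distrib_left times_divide_eq_right)
  then show ?thesis by (simp add: cis_mult[symmetric])
qed

lemma cis_div_eq_1_iff:
  assumes "n > 0"
  shows "cis (2 * pi * real j / real n) = 1 \<longleftrightarrow> n dvd j"
proof -
  have "cis (2 * pi * real (j mod n) / real n) = 1 \<longleftrightarrow> j mod n = 0"
    using inj_onD[OF inj_on_cis_div[OF assms], of "j mod n" 0] assms by auto
  then show ?thesis by (auto simp: cis_div_mod[OF assms])
qed

text \<open>Membership means exact multiplicative order \<open>n\<close>, which frees later
  arguments from the parametrization by \<open>cis\<close>.\<close>

lemma primitive_roots_iff:
  assumes "n > 0"
  shows "z \<in> primitive_roots n \<longleftrightarrow> (\<forall>e. z ^ e = 1 \<longleftrightarrow> n dvd e)"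
proof -
  have pow: "cis (2 * pi * real k / real n) ^ e = 1 \<longleftrightarrow> n dvd k * e" for k e
    using cis_div_eq_1_iff[OF assms, of "k * e"] by (simp add: DeMoivre mult_ac)
  show ?thesis
  proof
    assume "z \<in> primitive_roots n"
    then obtain k where k: "coprime k n" "z = cis (2 * pi * real k / real n)"
      by (auto simp: primitive_roots_def)
    show "\<forall>e. z ^ e = 1 \<longleftrightarrow> n dvd e"
      unfolding k(2) pow using k(1) by (simp add: coprime_commute coprime_dvd_mult_right_iff)
  next
    assume z: "\<forall>e. z ^ e = 1 \<longleftrightarrow> n dvd e"
    then have "z ^ n = 1" by simp
    then obtain k where k: "k < n" "z = cis (2 * pi * real k / real n)"
      using bij_betw_imp_surj_on[OF bij_betw_roots_unity[OF assms]] by (auto simp: image_iff)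
    define g where "g = gcd k n"
    obtain k' n' where kn: "k = g * k'" "n = g * n'"
      unfolding g_def by (meson dvdE gcd_dvd1 gcd_dvd2)
    \<comment> \<open>Hence \<open>z ^ n' = 1\<close>, so the order \<open>n\<close> divides
      \<open>n'\<close>; as \<open>n = g * n'\<close>, this forces \<open>g = 1\<close>.\<close>
    have "k * n' = k' * n" unfolding kn by (simp add: mult_ac)
    then have "n dvd n'" using z k(2) pow by (metis dvd_triv_right)
    moreover have "n' > 0" using kn(2) assms by (cases "n' = 0") auto
    ultimately have "g * n' \<le> n'" using kn(2) dvd_imp_le[of n n'] by simp
    moreover have "g > 0" using kn(2) assms by (cases "g = 0") auto
    ultimately have "g = 1" using \<open>n' > 0\<close> by simp
    then have "coprime k n" by (simp add: g_def coprime_iff_gcd_eq_1)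
    then show "z \<in> primitive_roots n" using k by (auto simp: primitive_roots_def)
  qed
qed

lemma primitive_roots_disjoint:
  "m > 0 \<Longrightarrow> n > 0 \<Longrightarrow> m \<noteq> n \<Longrightarrow> primitive_roots m \<inter> primitive_roots n = {}"
  by (auto simp: primitive_roots_iff) (metis dvd_antisym dvd_refl)

lemma finite_primitive_roots [simp]: "finite (primitive_roots n)"
  by (simp add: primitive_roots_def)

text \<open>The number \<open>d\<close> is the order of \<open>z\<close>, its least positive
  exponent.\<close>

lemma root_of_unity_primitive:
  fixes z :: complex
  assumes "z ^ n = 1" "n > 0"
  obtains d where "d dvd n" "z \<in> primitive_roots d"
proof -
  define d where "d = (LEAST e. e > 0 \<and> z ^ e = 1)"
  have d: "d > 0 \<and> z ^ d = 1"
    unfolding d_def by (rule LeastI[of _ n]) (use assms in auto)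
  have least: "\<not> (j > 0 \<and> z ^ j = 1)" if "j < d" for j
    using not_less_Least[OF that[unfolded d_def]] .
  have "z ^ e = 1 \<longleftrightarrow> d dvd e" for e
  proof
    assume "z ^ e = 1"
    then have "z ^ (e mod d) = 1" using d by (simp add: power_mod_of_root_of_unity)
    moreover have "e mod d < d" using d by simp
    ultimately have "e mod d = 0" using least by auto
    then show "d dvd e" by auto
  next
    assume "d dvd e"
    then show "z ^ e = 1" using d by (auto simp: power_mult)
  qed
  then show thesis using that[of d] d assms primitive_roots_iff by blast
qed

lemma roots_of_unity_partition:
  "n > 0 \<Longrightarrow> {z. z ^ n = 1} = (\<Union>d\<in>{d. d dvd n}. primitive_roots d)"
  using dvd_pos_nat by (auto simp: primitive_roots_iff elim!: root_of_unity_primitive)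

text \<open>If \<open>z\<close> and \<open>w\<close> have indices \<open>i\<close> and
  \<open>j\<close>, the exponent is \<open>j\<close> times an inverse of \<open>i\<close> modulo
  \<open>n\<close>.\<close>

lemma primitive_roots_power:
  assumes n: "n > 0" and z: "z \<in> primitive_roots n" and w: "w \<in> primitive_roots n"
  shows "\<exists>k. coprime k n \<and> w = z ^ k"
proof -
  obtain i j where i: "coprime i n" "z = cis (2 * pi * real i / real n)"
    and j: "coprime j n" "w = cis (2 * pi * real j / real n)"
    using z w by (auto simp: primitive_roots_def)
  \<comment> \<open>Writing \<open>1 mod n\<close> covers \<open>n = 1\<close>.\<close>
  obtain l where l: "(i * l) mod n = 1 mod n"
    using cong_solve_coprime_nat[OF i(1)] by (auto simp: cong_def)
  then have "coprime (i * l) n"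
    using coprime_mod_left_iff[of n "i * l"] coprime_mod_left_iff[of n 1] n by simp
  moreover have "(i * (l * j)) mod n = j mod n"
    using l by (metis mod_mult_left_eq mult.assoc mult_1)
  then have "w = cis (2 * pi * real (i * (l * j)) / real n)"
    unfolding j(2) using cis_div_mod[OF n] by metis
  then have "w = z ^ (l * j)" by (simp add: i(2) DeMoivre mult_ac)
  ultimately show ?thesis using j(1) by (intro exI[of _ "l * j"]) simp
qed

text \<open>A double root would be a common root of X^n - 1 and its derivative n X^(n-1), but the
  latter vanishes at most at 0.\<close>

lemma rsquarefree_dvd_X_power_minus_1:
  fixes G :: "complex poly"
  assumes "n > 0" and "G dvd monom 1 n - 1"
  shows "rsquarefree G"
proof -
  obtain H where H: "monom 1 n - 1 = G * H" using assms(2) by blast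
  have "\<not> (poly G a = 0 \<and> poly (pderiv G) a = 0)" for a
  proof
    assume a: "poly G a = 0 \<and> poly (pderiv G) a = 0"
    have "poly (monom 1 n - 1) a = 0" using a H by simp
    then have "a ^ n = 1" by (simp add: poly_monom)
    moreover have "poly (pderiv (monom 1 n - 1)) a = 0"
      unfolding H pderiv_mult using a by simp
    ultimately show False
      using assms(1) by (auto simp: pderiv_diff pderiv_monom poly_monom power_0_left)
  qed
  then show ?thesis by (simp add: rsquarefree_roots)
qed

lemma monic_X_power_minus_1:
  assumes "n > 0"
  shows "lead_coeff (monom 1 n - 1 :: 'a :: comm_ring_1 poly) = 1"
proof -
  have "degree (monom 1 n - 1 :: 'a poly) = n"
    using assms by (intro antisym degree_diff_le le_degree) (auto simp: degree_monom_le)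
  then show ?thesis using assms by simp
qed

text \<open>The roots are simple, and grouping them by their exact order gives the inner
  products.\<close>

lemma X_power_minus_1_decompose:
  assumes "n > 0"
  shows "monom 1 n - 1 = (\<Prod>d | d dvd n. \<Prod>z\<in>primitive_roots d. [:- z, 1:])"
proof -
  have "monom 1 n - 1 = (\<Prod>z | z ^ n = 1. [:- z, 1 :: complex:])"
    using complex_poly_decompose_rsquarefree[OF rsquarefree_dvd_X_power_minus_1[OF assms dvd_refl]]
    unfolding monic_X_power_minus_1[OF assms] by (simp add: poly_monom)
  also have "\<dots> = (\<Prod>d | d dvd n. \<Prod>z\<in>primitive_roots d. [:- z, 1:])"
    unfolding roots_of_unity_partition[OF assms] using assms primitive_roots_disjoint dvd_pos_nat
    by (intro prod.UNION_disjoint) auto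
  finally show ?thesis .
qed

text \<open>Pseudo-division by a monic polynomial is ordinary division over the integers. Its
  remainder is a multiple of \<open>g\<close> over the larger ring and has smaller degree, so it
  vanishes there.\<close>

lemma monic_division_descends_to_int:
  fixes f g :: "int poly" and h :: "'a :: {idom, ring_char_0} poly"
  assumes "of_int_poly f = of_int_poly g * h" and "lead_coeff g = 1"
  shows "\<exists>k. h = of_int_poly k"
proof -
  obtain q r where qr: "pseudo_divmod f g = (q, r)" by fastforce
  have "g \<noteq> 0" using assms(2) by auto
  from pseudo_divmod[OF this qr] assms(2)
  have f: "f = g * q + r" and r: "r = 0 \<or> degree r < degree g" by auto
  let ?R = "of_int_poly :: int poly \<Rightarrow> 'a poly"
  have eq: "?R g * (h - ?R q) = ?R r"
    using assms(1) unfolding f by (simp add: of_int_poly_hom.hom_add of_int_poly_hom.hom_mult algebra_simps)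
  have "h - ?R q = 0"
  proof (rule ccontr)
    assume nz: "h - ?R q \<noteq> 0"
    have "?R g \<noteq> 0" using \<open>g \<noteq> 0\<close> by simp
    then have "?R r \<noteq> 0" using nz by (simp add: eq[symmetric])
    moreover have "degree (?R r) \<ge> degree (?R g)"
      unfolding eq[symmetric] using nz \<open>?R g \<noteq> 0\<close> by (simp add: degree_mult_eq)
    ultimately show False using r by auto
  qed
  then show ?thesis by auto
qed

text \<open>Strong induction: the factors for proper divisors of \<open>n\<close> form a monic
  integer polynomial, and dividing X^n - 1 by it leaves an integer quotient.\<close>

lemma cyclotomic_int_exists:
  assumes "n > 0"
  shows "\<exists>p. of_int_poly p = (\<Prod>z\<in>primitive_roots n. [:- z, 1:])"
  using assms
proof (induction n rule: less_induct)
  case (less n)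
  let ?P = "\<lambda>d. \<Prod>z\<in>primitive_roots d. [:- z, 1:]"
  have "\<exists>p. of_int_poly p = ?P d" if "d dvd n" "d \<noteq> n" for d
  proof (rule less.IH)
    show "d < n" using that less.prems by (simp add: dvd_imp_le le_neq_implies_less)
    show "d > 0" using that(1) less.prems by (rule dvd_pos_nat[rotated])
  qed
  then obtain p where p: "\<And>d. d dvd n \<Longrightarrow> d \<noteq> n \<Longrightarrow> of_int_poly (p d) = ?P d" by metis
  define Q where "Q = (\<Prod>d | d dvd n \<and> d \<noteq> n. p d)"
  have fin: "finite {d. d dvd n}" using less.prems by simp
  have Q: "of_int_poly Q = (\<Prod>d | d dvd n \<and> d \<noteq> n. ?P d)"
    unfolding Q_def of_int_poly_hom.hom_prod using p by (intro prod.cong) auto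
  have "lead_coeff (of_int_poly Q :: complex poly) = 1"
    unfolding Q lead_coeff_prod by simp
  then have "lead_coeff Q = 1" by simp
  moreover have "of_int_poly (monom 1 n - 1) = of_int_poly Q * ?P n"
  proof -
    have "{d. d dvd n} = insert n {d. d dvd n \<and> d \<noteq> n}" by auto
    then show ?thesis
      using X_power_minus_1_decompose[OF less.prems] fin
      by (simp add: of_int_poly_hom.hom_minus Q mult.commute)
  qed
  ultimately obtain k where "?P n = of_int_poly k"
    using monic_division_descends_to_int by blast
  then show ?case by (intro exI[of _ k]) simp
qed

text \<open>Discharges the definite description in \<open>cyclotomic\<close>: existence is the
  previous lemma, uniqueness the injectivity of the embedding into complex polynomials.\<close>

lemma of_int_poly_cyclotomic:
  assumes "n > 0"
  shows "of_int_poly (cyclotomic n) = (\<Prod>z\<in>primitive_roots n. [:- z, 1:])"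
proof -
  have inj: "inj_on (\<lambda>k. cis (2 * pi * real k / real n)) {k. k < n \<and> coprime k n}"
    by (rule inj_on_subset[OF inj_on_cis_div[OF assms]]) auto
  have "(\<Prod>z\<in>primitive_roots n. [:- z, 1:])
      = (\<Prod>k\<in>{k. k < n \<and> coprime k n}. [:- cis (2 * pi * real k / real n), 1:])"
    unfolding primitive_roots_def prod.reindex[OF inj] by simp
  then obtain p where p: "of_int_poly p
      = (\<Prod>k\<in>{k. k < n \<and> coprime k n}. [:- cis (2 * pi * real k / real n), 1:])"
    and eq: "of_int_poly p = (\<Prod>z\<in>primitive_roots n. [:- z, 1:])"
    using cyclotomic_int_exists[OF assms] by metis
  have "cyclotomic n = p"
    unfolding cyclotomic_def
  proof (rule the_equality)
    fix q assume "of_int_poly q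
      = (\<Prod>k\<in>{k. k < n \<and> coprime k n}. [:- cis (2 * pi * real k / real n), 1:])"
    then show "q = p" using p of_int_poly_hom.injectivity by metis
  qed (rule p)
  then show ?thesis using eq by simp
qed

lemma X_power_minus_1_eq_prod_cyclotomic:
  assumes "n > 0"
  shows "monom 1 n - 1 = (\<Prod>d | d dvd n. cyclotomic d)"
proof -
  have "of_int_poly (cyclotomic d) = (\<Prod>z\<in>primitive_roots d. [:- z, 1:])" if "d dvd n" for d
    using assms that dvd_pos_nat of_int_poly_cyclotomic by blast
  then have "of_int_poly (monom 1 n - 1) = (of_int_poly (\<Prod>d | d dvd n. cyclotomic d) :: complex poly)"
    by (simp add: of_int_poly_hom.hom_minus of_int_poly_hom.hom_prod
      X_power_minus_1_decompose[OF assms])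
  then show ?thesis by (rule of_int_poly_hom.injectivity)
qed

text \<open>The exponent \<open>\<Prod>S\<close> is a positive common multiple of the indices, so
  the product is a subproduct of the factorization of X^n - 1 for that exponent. Distinctness of the
  factors is built into \<open>S\<close> being a set.\<close>

lemma prod_cyclotomic_dvd:
  assumes "finite S" "0 \<notin> S"
  shows "(\<Prod>d\<in>S. cyclotomic d) dvd monom 1 (\<Prod>S) - 1"
proof -
  have pos: "\<Prod>S > 0" using assms by (metis gr0I prod_zero_iff)
  have "S \<subseteq> {d. d dvd \<Prod>S}" using assms(1) by (auto intro: dvd_prodI)
  then show ?thesis
    unfolding X_power_minus_1_eq_prod_cyclotomic[OF pos] using pos
    by (intro prod_dvd_prod_subset) auto
qed

section \<open>Galois closure of the zeros of an integer divisor of X^n - 1\<close>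

section \<open>Roots of integer divisors of X^n - 1\<close>

text \<open>The characteristic polynomial of an integer matrix is monic with integer
  coefficients.\<close>

lemma algebraic_int_eigenvalue:
  fixes x :: complex
  assumes A: "A \<in> carrier_mat n n" and ev: "eigenvalue (map_mat of_int A) x"
  shows "algebraic_int x"
proof -
  have "poly (char_poly (map_mat of_int A)) x = 0"
    using ev eigenvalue_root_char_poly[of "map_mat of_int A" n x] A by simp
  then have "poly (of_int_poly (char_poly A)) x = 0"
    by (simp add: of_int_hom.char_poly_hom[OF A])
  then show ?thesis
    using degree_monic_char_poly[OF A] algebraic_int_altdef_ipoly[of x] by metis
qed

lemma algebraic_int_poly_root_of_unity:
  fixes z :: complex
  assumes z: "z ^ n = 1" and n: "n > 0"
  shows "algebraic_int (poly (of_int_poly v) z)"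
proof -
  (* Multiplication by v on the powers of z, with exponents reduced modulo n. *)
  define A :: "int mat" where
    "A = mat n n (\<lambda>(i, j). \<Sum>l\<le>degree v. if (i + l) mod n = j then coeff v l else 0)"
  define w where "w = vec n (\<lambda>j. z ^ j)"
  have A: "A \<in> carrier_mat n n" by (simp add: A_def)
  \<comment> \<open>The powers of \<open>z\<close> form an eigenvector with the value of
    \<open>v\<close> at \<open>z\<close> as eigenvalue; \<open>z ^ n = 1\<close> justifies reducing
    exponents.\<close>
  have "map_mat of_int A *\<^sub>v w = poly (of_int_poly v) z \<cdot>\<^sub>v w"
  proof (rule eq_vecI)
    fix i assume "i < dim_vec (poly (of_int_poly v) z \<cdot>\<^sub>v w)"
    then have i: "i < n" by (simp add: w_def)
    have "(map_mat of_int A *\<^sub>v w) $ i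
        = (\<Sum>j<n. (\<Sum>l\<le>degree v. if (i + l) mod n = j then of_int (coeff v l) else 0) * z ^ j)"
      using i A unfolding A_def w_def
      by (simp add: scalar_prod_def of_int_hom.hom_sum if_distrib lessThan_atLeast0 cong: if_cong)
    also have "\<dots> = (\<Sum>l\<le>degree v. \<Sum>j<n. if (i + l) mod n = j then of_int (coeff v l) * z ^ j else 0)"
      unfolding sum_distrib_right by (subst sum.swap) (intro sum.cong refl, simp)
    also have "\<dots> = (\<Sum>l\<le>degree v. of_int (coeff v l) * z ^ (i + l))"
      using n by (simp add: sum.delta' power_mod_of_root_of_unity[OF z])
    also have "\<dots> = poly (of_int_poly v) z * z ^ i"
      by (simp add: poly_altdef sum_distrib_left sum_distrib_right power_add mult_ac)
    finally show "(map_mat of_int A *\<^sub>v w) $ i = (poly (of_int_poly v) z \<cdot>\<^sub>v w) $ i"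
      using i by (simp add: w_def)
  qed (use A in \<open>auto simp: w_def\<close>)
  moreover have "w \<noteq> 0\<^sub>v n"
  proof
    assume "w = 0\<^sub>v n"
    then have "w $ 0 = 0" using n by simp
    then show False using n by (simp add: w_def)
  qed
  ultimately have "eigenvalue (map_mat of_int A) (poly (of_int_poly v) z)"
    unfolding eigenvalue_def eigenvector_def using A by (intro exI[of _ w]) (auto simp: w_def)
  then show ?thesis by (rule algebraic_int_eigenvalue[OF A])
qed

text \<open>The inner binomial coefficients are divisible by \<open>q\<close>. A general commutative
  ring is needed to serve both integers and integer polynomials.\<close>

lemma prime_power_add:
  fixes x y :: "'a :: comm_ring_1"
  assumes "prime (q :: nat)"
  shows "\<exists>w. (x + y) ^ q = x ^ q + y ^ q + of_nat q * w"
proof -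
  have q: "q > 0" using assms prime_gt_0_nat by blast
  have "(x + y) ^ q = (\<Sum>k\<le>q. of_nat (q choose k) * x ^ k * y ^ (q - k))"
    by (rule binomial_ring)
  also have "{..q} = insert 0 (insert q {1..<q})" using q by auto
  also have "(\<Sum>k\<in>\<dots>. of_nat (q choose k) * x ^ k * y ^ (q - k))
      = x ^ q + y ^ q + (\<Sum>k=1..<q. of_nat (q choose k) * x ^ k * y ^ (q - k))"
    using q by simp
  also have "(\<Sum>k=1..<q. of_nat (q choose k) * x ^ k * y ^ (q - k))
      = (\<Sum>k=1..<q. of_nat q * (of_nat ((q choose k) div q) * x ^ k * y ^ (q - k)))"
  proof (rule sum.cong)
    fix k assume "k \<in> {1..<q}"
    then have "q dvd q choose k" using assms by (intro dvd_choose_prime) auto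
    then have "(of_nat (q choose k) :: 'a) = of_nat q * of_nat ((q choose k) div q)"
      by (metis dvd_mult_div_cancel of_nat_mult)
    then show "of_nat (q choose k) * x ^ k * y ^ (q - k)
        = of_nat q * (of_nat ((q choose k) div q) * x ^ k * y ^ (q - k))"
      by (simp add: mult_ac)
  qed simp
  finally show ?thesis unfolding sum_distrib_left[symmetric] by blast
qed

text \<open>Fermat's little theorem, by induction upwards and downwards from 0.\<close>

lemma int_power_prime_cong:
  fixes a :: int
  assumes "prime (q :: nat)"
  shows "\<exists>b. a ^ q = a + int q * b"
proof (induction a rule: int_induct[where k = 0])
  case base
  then show ?case using prime_gt_0_nat[OF assms] by (auto simp: power_0_left)
next
  case (step1 a)
  then obtain b where "a ^ q = a + int q * b" by blast
  moreover obtain w where "(a + 1) ^ q = a ^ q + 1 ^ q + int q * w"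
    using prime_power_add[OF assms] by blast
  ultimately have "(a + 1) ^ q = (a + 1) + int q * (b + w)" by (simp add: algebra_simps)
  then show ?case by blast
next
  case (step2 a)
  then obtain b where "a ^ q = a + int q * b" by blast
  moreover obtain w where "((a - 1) + 1) ^ q = (a - 1) ^ q + 1 ^ q + int q * w"
    using prime_power_add[OF assms] by blast
  ultimately have "(a - 1) ^ q = (a - 1) + int q * (b - w)" by (simp add: algebra_simps)
  then show ?case by blast
qed

text \<open>The Frobenius congruence modulo \<open>q\<close>: constants are covered by Fermat, and
  induction on the coefficients uses additivity of the \<open>q\<close>-th power modulo
  \<open>q\<close>.\<close>

lemma int_poly_prime_power:
  assumes "prime (q :: nat)"
  shows "\<exists>u. g \<circ>\<^sub>p monom 1 q = g ^ q + of_nat q * (u :: int poly)"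
proof (induction g)
  case 0
  then show ?case using prime_gt_0_nat[OF assms] by (auto simp: power_0_left)
next
  case (pCons a g)
  then obtain u where u: "g \<circ>\<^sub>p monom 1 q = g ^ q + of_nat q * u" by blast
  obtain b where b: "a ^ q = a + int q * b" using int_power_prime_cong[OF assms] by blast
  have split: "pCons a g = [:a:] + monom 1 1 * g" by (simp add: monom_altdef)
  obtain w where "(pCons a g) ^ q = [:a:] ^ q + (monom 1 1 * g) ^ q + of_nat q * w"
    unfolding split using prime_power_add[OF assms] by blast
  moreover have "[:a:] ^ q = [:a:] + of_nat q * [:b:]"
    unfolding poly_const_pow b by (simp add: of_nat_poly)
  moreover have "(monom 1 1 :: int poly) ^ q = monom 1 q" by (simp add: monom_power)
  moreover have "pCons a g \<circ>\<^sub>p monom 1 q = [:a:] + monom 1 q * (g \<circ>\<^sub>p monom 1 q)"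
    by (simp add: pcompose_pCons)
  ultimately have "pCons a g \<circ>\<^sub>p monom 1 q
      = (pCons a g) ^ q + of_nat q * (monom 1 q * u - [:b:] - w)"
    by (simp add: u algebra_simps power_mult_distrib)
  then show ?case by blast
qed

text \<open>This is the classical use of the separability of X^n - 1 modulo \<open>q\<close>,
  carried out at the single point \<open>z ^ q\<close> rather than over a field with
  \<open>q\<close> elements.\<close>

lemma root_prime_power:
  fixes g :: "int poly" and z :: complex
  assumes n: "n > 0" and gh: "monom 1 n - 1 = g * h"
    and z: "poly (of_int_poly g) z = 0" and q: "prime (q :: nat)" and qn: "\<not> q dvd n"
  shows "poly (of_int_poly g) (z ^ q) = 0"
proof (rule ccontr)
  assume nz: "poly (of_int_poly g) (z ^ q) \<noteq> 0"
  let ?R = "of_int_poly :: int poly \<Rightarrow> complex poly"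
  have GH: "monom 1 n - 1 = ?R g * ?R h"
    using arg_cong[OF gh, of ?R] by (simp add: of_int_poly_hom.hom_minus of_int_poly_hom.hom_mult)
  have "poly (monom 1 n - 1) z = 0" unfolding GH using z by simp
  then have zn: "z ^ n = 1" by (simp add: poly_monom)
  have "(z ^ q) ^ n = (z ^ n) ^ q" by (simp add: mult.commute flip: power_mult)
  then have zqn: "(z ^ q) ^ n = 1" using zn by simp
  then have "poly (monom 1 n - 1) (z ^ q) = 0" by (simp add: poly_monom)
  then have hz: "poly (?R h) (z ^ q) = 0" using nz unfolding GH by simp
  have "poly (pderiv (monom 1 n - 1)) (z ^ q) = poly (?R g) (z ^ q) * poly (pderiv (?R h)) (z ^ q)"
    unfolding GH pderiv_mult using hz by simp
  then have deriv: "of_nat n * (z ^ q) ^ (n - 1) = poly (?R g) (z ^ q) * poly (pderiv (?R h)) (z ^ q)"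
    by (simp add: pderiv_diff pderiv_monom poly_monom)
  \<comment> \<open>One more factor \<open>z ^ q\<close> completes the power to
    \<open>(z ^ q) ^ n = 1\<close>.\<close>
  have "of_nat n = of_nat n * (z ^ q) ^ (n - 1) * z ^ q"
    using power_minus_mult[OF n, of "z ^ q"] zqn by (simp add: mult.assoc)
  then have nq: "of_nat n = poly (?R g) (z ^ q) * poly (pderiv (?R h)) (z ^ q) * z ^ q"
    unfolding deriv .
  obtain u where u: "g \<circ>\<^sub>p monom 1 q = g ^ q + of_nat q * u"
    using int_poly_prime_power[OF q] by blast
  have comp: "poly (?R p) (z ^ q) = poly (?R (p \<circ>\<^sub>p monom 1 q)) z" for p
    by (simp add: of_int_hom.map_poly_pcompose poly_pcompose poly_monom)
  \<comment> \<open>The summand \<open>g ^ q\<close> of the congruence vanishes at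
    \<open>z\<close>.\<close>
  have "poly (?R g) (z ^ q) = of_nat q * poly (?R u) z"
    unfolding comp u using z prime_gt_0_nat[OF q]
    by (simp add: of_int_poly_hom.hom_add of_int_poly_hom.hom_mult of_int_poly_hom.hom_power
      of_nat_poly of_int_hom.map_poly_hom_smult power_0_left)
  \<comment> \<open>Collects all factors other than \<open>q\<close>, with arguments
    \<open>z ^ q\<close> rewritten as polynomials in \<open>z\<close>.\<close>
  moreover define v where "v = u * (pderiv h \<circ>\<^sub>p monom 1 q) * monom 1 q"
  ultimately have "of_nat n = of_nat q * poly (?R v) z"
    unfolding nq
    by (simp add: v_def of_int_poly_hom.hom_mult poly_monom comp[symmetric] of_int_hom.map_poly_pderiv)
  then have quot: "poly (?R v) z = of_nat n / of_nat q"
    using prime_gt_0_nat[OF q] by (simp add: field_simps)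
  then have "algebraic_int (of_nat n / of_nat q :: complex)"
    using algebraic_int_poly_root_of_unity[OF zn n, of v] by simp
  then have "(of_nat n / of_nat q :: complex) \<in> \<int>"
    by (rule rational_algebraic_int_is_int) simp
  then obtain k where "(of_nat n / of_nat q :: complex) = of_int k" by (auto elim: Ints_cases)
  then have "(of_int (int n) :: complex) = of_int (int q * k)"
    using prime_gt_0_nat[OF q] by (simp add: field_simps)
  then have "int n = int q * k" by (simp only: of_int_eq_iff)
  then show False using qn by (metis dvd_triv_left int_dvd_int_iff)
qed

text \<open>The prime factors of \<open>k\<close> are peeled off one at a time; \<open>z\<close> is
  generalized because each step replaces it by \<open>z ^ q\<close>.\<close>

lemma root_coprime_power:
  fixes g :: "int poly" and z :: complex
  assumes n: "n > 0" and gh: "g dvd monom 1 n - 1"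
  shows "poly (of_int_poly g) z = 0 \<Longrightarrow> coprime k n \<Longrightarrow> k > 0 \<Longrightarrow> poly (of_int_poly g) (z ^ k) = 0"
proof (induction k arbitrary: z rule: less_induct)
  case (less k)
  show ?case
  proof (cases "k = 1")
    case False
    then obtain q where q: "prime q" "q dvd k" using prime_factor_nat by blast
    then obtain l where l: "k = q * l" by blast
    have "\<not> q dvd n"
      using q less.prems(2) by (metis coprime_common_divisor not_prime_unit)
    then have "poly (of_int_poly g) (z ^ q) = 0"
      using root_prime_power[OF n _ less.prems(1) q(1)] gh by (metis dvdE)
    moreover have "l < k" "l > 0" using l less.prems(3) prime_gt_1_nat[OF q(1)] by auto
    moreover have "coprime l n" using less.prems(2) l by simp
    ultimately show ?thesis using less.IH[of l "z ^ q"] by (simp add: l power_mult)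
  qed (use less.prems in simp)
qed

text \<open>Passing between primitive \<open>d\<close>-th roots gives an exponent coprime to
  \<open>d\<close> only, whereas \<open>root_coprime_power\<close> asks for one coprime to
  \<open>n\<close>.\<close>

lemma lift_coprime:
  fixes k d n :: nat
  assumes "n > 0" and "coprime k d"
  shows "\<exists>k'>0. coprime k' n \<and> k' mod d = k mod d"
proof -
  \<comment> \<open>Adding \<open>d * \<Prod>P\<close> to \<open>k\<close> works: a prime of
    \<open>n\<close> divides exactly one of the two summands. If it divides \<open>k\<close>, it
    divides neither \<open>d\<close> nor \<open>\<Prod>P\<close>; otherwise it belongs to
    \<open>P\<close>.\<close>
  define P where "P = {p. prime p \<and> p dvd n \<and> \<not> p dvd k}"
  have fin: "finite P"
    unfolding P_def by (rule finite_subset[OF _ finite_divisors_nat[OF assms(1)]]) auto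
  have "\<Prod>P > 0" using fin by (intro prod_pos) (auto simp: P_def prime_gt_0_nat)
  have "coprime (k + d * \<Prod>P) n"
  proof (rule ccontr)
    assume "\<not> coprime (k + d * \<Prod>P) n"
    then have "gcd (k + d * \<Prod>P) n \<noteq> 1" by (simp add: coprime_iff_gcd_eq_1)
    then obtain p where "prime p" "p dvd gcd (k + d * \<Prod>P) n"
      using prime_factor_nat by blast
    then have p: "prime p" "p dvd k + d * \<Prod>P" "p dvd n" by simp_all
    show False
    proof (cases "p dvd k")
      case True
      then have "p dvd d * \<Prod>P" using p(2) by (simp add: dvd_add_right_iff)
      moreover have "\<not> p dvd d" using True assms(2) p(1) by (metis coprime_common_divisor not_prime_unit)
      ultimately have "p dvd \<Prod>P" using p(1) by (simp add: prime_dvd_mult_iff)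
      then obtain r where "r \<in> P" "p dvd r" using p(1) fin by (auto simp: prime_dvd_prod_iff)
      then show False using True p(1) by (auto simp: P_def dest: primes_dvd_imp_eq)
    next
      case False
      then have "p dvd \<Prod>P" using p fin by (intro dvd_prodI) (auto simp: P_def)
      then show False using False p(2) by (simp add: dvd_add_left_iff)
    qed
  qed
  \<comment> \<open>For \<open>k = 0\<close>, coprimality forces \<open>d = 1\<close>.\<close>
  moreover have "k + d * \<Prod>P > 0" using assms(2) \<open>\<Prod>P > 0\<close> by (cases "k = 0") auto
  ultimately show ?thesis by (intro exI[of _ "k + d * \<Prod>P"]) auto
qed

hide_const (open) module.smult
text \<open>The zeros of \<open>g\<close> are simple and form a union of full sets
  \<open>primitive_roots d\<close>, so \<open>g\<close> is its leading coefficient, a unit, times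
  the matching cyclotomic polynomials.\<close>

lemma dvd_X_power_minus_1_imp_prod_cyclotomic:
  fixes g :: "int poly"
  assumes n: "n > 0" and dvd: "g dvd monom 1 n - 1"
  shows "\<exists>S s. finite S \<and> 0 \<notin> S \<and> (s = 1 \<or> s = -1) \<and> g = smult s (\<Prod>d\<in>S. cyclotomic d)"
proof -
  let ?G = "of_int_poly g :: complex poly"
  obtain h where h: "monom 1 n - 1 = g * h" using dvd by blast
  have "lead_coeff g * lead_coeff h = 1"
    using monic_X_power_minus_1[OF n, where 'a = int] by (simp add: h lead_coeff_mult)
  then have s: "lead_coeff g = 1 \<or> lead_coeff g = -1" by (auto simp: zmult_eq_1_iff)
  have "monom 1 n - 1 = ?G * of_int_poly h"
    using arg_cong[OF h, of "of_int_poly :: int poly \<Rightarrow> complex poly"]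
    by (simp add: of_int_poly_hom.hom_minus of_int_poly_hom.hom_mult)
  then have Gdvd: "?G dvd monom 1 n - 1" by (metis dvd_triv_left)
  have unity: "z ^ n = 1" if "poly ?G z = 0" for z
  proof -
    have "poly (monom 1 n - 1) z = 0" using Gdvd that by (metis dvdE mult_zero_left poly_mult)
    then show ?thesis by (simp add: poly_monom)
  qed
  have closed: "poly ?G w = 0"
    if d: "d dvd n" and z: "z \<in> primitive_roots d" "poly ?G z = 0" and w: "w \<in> primitive_roots d"
    for d z w
  proof -
    have "d > 0" using d n by (rule dvd_pos_nat[rotated])
    obtain k where k: "coprime k d" "w = z ^ k"
      using primitive_roots_power[OF \<open>d > 0\<close> z(1) w] by blast
    obtain l where l: "l > 0" "coprime l n" "l mod d = k mod d"
      using lift_coprime[OF n k(1)] by blast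
    have "z ^ d = 1" using z(1) \<open>d > 0\<close> by (simp add: primitive_roots_iff)
    then have "w = z ^ l" unfolding k(2) using l(3) by (metis power_mod_of_root_of_unity)
    then show ?thesis using root_coprime_power[OF n dvd z(2) l(2,1)] by simp
  qed
  \<comment> \<open>By \<open>closed\<close>, a single zero of order \<open>d\<close> already puts
    \<open>d\<close> into \<open>S\<close>.\<close>
  define S where "S = {d. d dvd n \<and> primitive_roots d \<subseteq> {z. poly ?G z = 0}}"
  have pos: "d > 0" if "d \<in> S" for d using that n dvd_pos_nat by (auto simp: S_def)
  have fin: "finite S" unfolding S_def using n by simp
  have roots: "{z. poly ?G z = 0} = (\<Union>d\<in>S. primitive_roots d)"
  proof
    show "{z. poly ?G z = 0} \<subseteq> (\<Union>d\<in>S. primitive_roots d)"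
    proof
      fix z assume z: "z \<in> {z. poly ?G z = 0}"
      then obtain d where d: "d dvd n" "z \<in> primitive_roots d"
        using root_of_unity_primitive[OF unity n] by blast
      then have "d \<in> S" using closed z by (auto simp: S_def)
      then show "z \<in> (\<Union>d\<in>S. primitive_roots d)" using d by blast
    qed
  qed (auto simp: S_def)
  have "?G = smult (of_int (lead_coeff g)) (\<Prod>z | poly ?G z = 0. [:- z, 1:])"
    using complex_poly_decompose_rsquarefree[OF rsquarefree_dvd_X_power_minus_1[OF n Gdvd]] by simp
  also have "(\<Prod>z | poly ?G z = 0. [:- z, 1:]) = (\<Prod>d\<in>S. \<Prod>z\<in>primitive_roots d. [:- z, 1:])"
    unfolding roots using fin pos primitive_roots_disjoint by (intro prod.UNION_disjoint) auto
  also have "\<dots> = of_int_poly (\<Prod>d\<in>S. cyclotomic d)"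
    using pos by (simp add: of_int_poly_hom.hom_prod of_int_poly_cyclotomic)
  finally have "?G = of_int_poly (smult (lead_coeff g) (\<Prod>d\<in>S. cyclotomic d))"
    by (simp add: of_int_hom.map_poly_hom_smult)
  then have "g = smult (lead_coeff g) (\<Prod>d\<in>S. cyclotomic d)"
    by (rule of_int_poly_hom.injectivity)
  then show ?thesis using fin pos s by blast
qed

section \<open>Periodicity as a power series identity\<close>

section \<open>Generating functions\<close>

no_notation vec_index (infixl "$" 100)
unbundle fps_syntax

lemma fps_mult_one_minus_X_power_nth:
  fixes f :: "'a :: comm_ring_1 fps"
  shows "(f * (1 - fps_X ^ m)) $ n = f $ n - (if n < m then 0 else f $ (n - m))"
  by (simp add: right_diff_distrib fps_X_power_mult_right_nth)

lemma fps_sum_const_X_power_nth: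
  fixes a :: "nat \<Rightarrow> 'a :: comm_ring_1"
  shows "(\<Sum>k<m. fps_const (a k) * fps_X ^ k) $ n = (if n < m then a n else 0)"
proof -
  have "(\<Sum>k<m. fps_const (a k) * fps_X ^ k) $ n = (\<Sum>k<m. if k = n then a k else 0)"
    unfolding fps_sum_nth by (intro sum.cong) auto
  then show ?thesis by simp
qed

text \<open>Beyond index \<open>m\<close> the product has coefficients
  \<open>a n - a (n - m)\<close>, so periodicity says that only the first \<open>m\<close>
  coefficients survive.\<close>

lemma periodic_iff_fps:
  fixes a :: "nat \<Rightarrow> 'a :: comm_ring_1"
  shows "(\<forall>n. a (n + m) = a n) \<longleftrightarrow>
    Abs_fps a * (1 - fps_X ^ m) = (\<Sum>k<m. fps_const (a k) * fps_X ^ k)"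
    (is "?L \<longleftrightarrow> ?R")
proof
  assume ?L
  then have "a n = a (n - m)" if "n \<ge> m" for n using that by (metis le_add_diff_inverse2)
  then show ?R
    by (auto simp: fps_eq_iff fps_mult_one_minus_X_power_nth fps_sum_const_X_power_nth not_less)
next
  assume ?R
  then have "(Abs_fps a * (1 - fps_X ^ m)) $ (n + m)
      = (\<Sum>k<m. fps_const (a k) * fps_X ^ k) $ (n + m)" for n
    by simp
  then have "a (n + m) - a n = 0" for n
    unfolding fps_mult_one_minus_X_power_nth fps_sum_const_X_power_nth by simp
  then show ?L by simp
qed

lemma fps_eq_divide_iff:
  fixes f q u :: "'a :: field fps"
  assumes "u $ 0 \<noteq> 0"
  shows "f = q / u \<longleftrightarrow> f * u = q"
proof -
  have "u \<noteq> 0" "u dvd q" using assms by (auto intro: unit_imp_dvd)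
  then show ?thesis by auto
qed

section \<open>The generating function of trains\<close>

lemma coeff_Cpoly:
  assumes "rod_finite R"
  shows "coeff (Cpoly R) n = (if n > 0 then Cnt n R else 0)"
  using assms by (simp add: Cpoly_def coeff_sum rod_finite_def)

text \<open>The recurrence in power series form. It is kept over the integers, since the
  divisibility in \<open>P5\<close> lives in integer polynomials.\<close>

lemma Ftr_genfun:
  assumes "rodset R" "rod_finite R"
  shows "fps_of_poly (1 - Cpoly R) * Abs_fps (\<lambda>n. Ftr n R) = 1"
proof -
  have "Ftr n R - (fps_of_poly (Cpoly R) * Abs_fps (\<lambda>n. Ftr n R)) $ n = (1 :: int fps) $ n" for n
  proof (cases n)
    case 0
    then show ?thesis using Ftr_0[OF assms(1)] by (simp add: coeff_Cpoly[OF assms(2)])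
  next
    case (Suc l)
    have "(fps_of_poly (Cpoly R) * Abs_fps (\<lambda>n. Ftr n R)) $ n
        = (\<Sum>i\<in>{1..Suc l}. Cnt i R * Ftr (Suc l - i) R)"
      unfolding fps_mult_nth Suc
      \<comment> \<open>The summand \<open>i = 0\<close> drops out because \<open>Cpoly R\<close>
        has no constant term.\<close>
      by (rule sum.mono_neutral_cong_right) (auto simp: coeff_Cpoly[OF assms(2)])
    then show ?thesis using Ftr_Suc[OF assms(1), of l] by (simp add: Suc)
  qed
  then show ?thesis by (simp add: fps_eq_iff fps_of_poly_diff left_diff_distrib)
qed

lemma linear_recurrence_Ftr:
  assumes "rodset R" and "rod_finite R" and "\<not> rod_equiv R ({} :: 'c rod set)"
  shows "linear_recurrence (\<lambda>n. Ftr n R) (\<lambda>n. Cnt n R) (rod_max R)"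
proof -
  let ?A = "{n. 0 < n \<and> Cnt n R \<noteq> 0}"
  have fin: "finite ?A" using assms(2) by (simp add: rod_finite_def)
  have "?A \<noteq> {}" using assms(3) by (auto simp: rod_equiv_def Cnt_def)
  then have m: "rod_max R \<in> ?A" unfolding rod_max_def using fin Max_in by blast
  have zero: "Cnt k R = 0" if "k > rod_max R" for k
  proof (rule ccontr)
    assume "Cnt k R \<noteq> 0"
    then have "k \<le> rod_max R" unfolding rod_max_def using that fin by (intro Max_ge) auto
    then show False using that by simp
  qed
  show ?thesis
  proof
    fix n assume n: "n \<ge> rod_max R"
    then obtain l where l: "n = Suc l" using m by (cases n) auto
    have "Ftr n R = (\<Sum>k\<in>{1..n}. Cnt k R * Ftr (n - k) R)"
      unfolding l by (rule Ftr_Suc[OF assms(1)])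
    also have "\<dots> = (\<Sum>k=1..rod_max R. Cnt k R * Ftr (n - k) R)"
      using n zero by (intro sum.mono_neutral_right) auto
    finally show "Ftr n R = (\<Sum>k=1..rod_max R. Cnt k R * Ftr (n - k) R)" .
  qed (use m in auto)
qed

text \<open>The cofactor is the polynomial \<open>q\<close> of the first \<open>p\<close> values:
  multiplying G (1 - x^p) = q by 1 - C cancels G.\<close>

lemma Ftr_periodic_imp_dvd:
  assumes "rodset R" "rod_finite R" and "\<forall>n. Ftr (n + p) R = Ftr n R"
  shows "(1 - Cpoly R) dvd (1 - monom 1 p)"
proof -
  let ?G = "Abs_fps (\<lambda>n. Ftr n R)"
  define q where "q = (\<Sum>k<p. monom (Ftr k R) k)"
  have "?G * (1 - fps_X ^ p) = fps_of_poly q"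
    using assms(3) periodic_iff_fps[of "\<lambda>n. Ftr n R" p]
    by (simp add: q_def fps_of_poly_sum fps_of_poly_monom)
  then have "fps_of_poly ((1 - Cpoly R) * q) = fps_of_poly (1 - Cpoly R) * ?G * (1 - fps_X ^ p)"
    by (simp add: fps_of_poly_mult mult.assoc)
  also have "\<dots> = fps_of_poly (1 - monom 1 p)"
    unfolding Ftr_genfun[OF assms(1,2)] by (simp add: fps_of_poly_diff fps_of_poly_monom')
  finally have "(1 - Cpoly R) * q = 1 - monom 1 p" by (simp only: fps_of_poly_eq_iff)
  then show ?thesis by (metis dvd_triv_left)
qed

text \<open>G (1 - x^p) equals the cofactor, a polynomial, so its coefficients vanish beyond the
  degree.\<close>

lemma dvd_imp_Ftr_eventually_periodic:
  assumes "rodset R" "rod_finite R" and "(1 - Cpoly R) dvd (1 - monom 1 p)"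
  shows "\<exists>N. \<forall>n\<ge>N. Ftr (n + p) R = Ftr n R"
proof -
  let ?G = "Abs_fps (\<lambda>n. Ftr n R)"
  obtain q where q: "1 - monom 1 p = (1 - Cpoly R) * q" using assms(3) by blast
  have "?G * (1 - fps_X ^ p) = ?G * fps_of_poly (1 - monom 1 p)"
    by (simp add: fps_of_poly_diff fps_of_poly_monom')
  also have "\<dots> = (fps_of_poly (1 - Cpoly R) * ?G) * fps_of_poly q"
    by (simp only: q fps_of_poly_mult mult_ac)
  also have "\<dots> = fps_of_poly q" by (simp only: Ftr_genfun[OF assms(1,2)] mult_1)
  finally have eq: "?G * (1 - fps_X ^ p) = fps_of_poly q" .
  have "Ftr (n + p) R = Ftr n R" if "n \<ge> Suc (degree q)" for n
    using arg_cong[OF eq, of "\<lambda>f. f $ (n + p)"] that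
    by (simp add: fps_mult_one_minus_X_power_nth coeff_eq_0)
  then show ?thesis by blast
qed

theorem mainTheorem14:
  fixes R :: "'c rod set"
  assumes "rodset R" and "rod_finite R"
    and "\<not> rod_equiv R ({} :: 'c rod set)"
  defines "m \<equiv> rod_max R"
  defines "P1 \<equiv> (\<exists>p>0. \<exists>N. \<forall>n\<ge>N. Ftr (n + p) R = Ftr n R)"
    and "P2 \<equiv> (\<exists>B. \<forall>n. \<bar>Ftr n R\<bar> \<le> B)"
    and "P3 \<equiv> (\<exists>a a'. a < a' \<and> (\<forall>j<m. Ftr (a + j) R = Ftr (a' + j) R))"
    and "P4 \<equiv> (\<exists>p>0. \<forall>n. Ftr (n + p) R = Ftr n R)"
    and "P5 \<equiv> (\<exists>p\<ge>1. (1 - Cpoly R) dvd (1 - monom 1 p))"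
    and "P6 \<equiv> (\<exists>S s. finite S \<and> 0 \<notin> S \<and> (s = 1 \<or> s = -1) \<and>
                  1 - Cpoly R = smult s (\<Prod>d\<in>S. cyclotomic d))"
    and "P7 \<equiv> (\<exists>m'\<ge>1. Gfps R =
                  (\<Sum>k<m'. fps_const (of_int (Ftr k R)) * fps_X ^ k) / (1 - fps_X ^ m'))"
  shows "(P1 \<longleftrightarrow> P2) \<and> (P1 \<longleftrightarrow> P3) \<and> (P1 \<longleftrightarrow> P4) \<and> (P1 \<longleftrightarrow> P5)
         \<and> (P1 \<longleftrightarrow> P6) \<and> (P1 \<longleftrightarrow> P7)"
proof -
  interpret linear_recurrence "\<lambda>n. Ftr n R" "\<lambda>n. Cnt n R" m
    unfolding m_def by (rule linear_recurrence_Ftr[OF assms(1-3)])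
  have dvd_swap: "(1 - Cpoly R) dvd (1 - monom 1 p) \<longleftrightarrow> (1 - Cpoly R) dvd (monom 1 p - 1)" for p
    using dvd_minus_iff[of "1 - Cpoly R" "monom 1 p - 1"] by simp
  \<comment> \<open>Two cycles through \<open>P1\<close>, namely \<open>P1\<close>,
    \<open>P2\<close>, \<open>P3\<close> and \<open>P1\<close>, \<open>P4\<close>,
    \<open>P5\<close>; then \<open>P6\<close> is tied to \<open>P5\<close> and \<open>P7\<close> to
    \<open>P4\<close>.\<close>
  have "P1 \<Longrightarrow> P2"
    unfolding P1_def P2_def using eventually_periodic_imp_bounded[of _ _ "\<lambda>n. Ftr n R"] by blast
  moreover have "P2 \<Longrightarrow> P3"
    unfolding P2_def P3_def using bounded_imp_equal_windows by blast
  moreover have "P3 \<Longrightarrow> P1"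
  proof -
    assume P3
    then obtain a b where "a < b" and "\<forall>j<m. Ftr (a + j) R = Ftr (b + j) R"
      unfolding P3_def by blast
    then have *: "Ftr (a + j) R = Ftr (b + j) R" for j
      using window_determines_future[of a b j] by simp
    have "Ftr (n + (b - a)) R = Ftr n R" if "n \<ge> a" for n
      using *[of "n - a"] that \<open>a < b\<close> by (simp add: add.commute)
    then show P1 unfolding P1_def using \<open>a < b\<close> by (intro exI[of _ "b - a"]) auto
  qed
  moreover have "P1 \<Longrightarrow> P4"
    unfolding P1_def P4_def using purely_periodic by blast
  moreover have "P4 \<Longrightarrow> P5"
  proof -
    assume P4
    then obtain p where "p > 0" "\<forall>n. Ftr (n + p) R = Ftr n R" unfolding P4_def by blast
    then show P5
      unfolding P5_def using Ftr_periodic_imp_dvd[OF assms(1,2)] by (intro exI[of _ p]) auto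
  qed
  moreover have "P5 \<Longrightarrow> P1 \<and> P6"
  proof -
    assume P5
    then obtain p where p: "p > 0" "(1 - Cpoly R) dvd (1 - monom 1 p)"
      unfolding P5_def by (auto simp: Suc_le_eq)
    have P1
      unfolding P1_def
      using p(1) dvd_imp_Ftr_eventually_periodic[OF assms(1,2) p(2)] by blast
    moreover have P6
      unfolding P6_def
      using p(2) unfolding dvd_swap by (rule dvd_X_power_minus_1_imp_prod_cyclotomic[OF p(1)])
    ultimately show "P1 \<and> P6" by blast
  qed
  moreover have "P6 \<Longrightarrow> P5"
  proof -
    assume P6
    then obtain S s where S: "finite S" "0 \<notin> S" and s: "s = 1 \<or> s = -1"
      and eq: "1 - Cpoly R = smult s (\<Prod>d\<in>S. cyclotomic d)"
      unfolding P6_def by blast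
    \<comment> \<open>The period is \<open>\<Prod>S\<close>; a unit \<open>s\<close> does not affect
      divisibility.\<close>
    have "(1 - Cpoly R) dvd (monom 1 (\<Prod>S) - 1)"
      unfolding eq using prod_cyclotomic_dvd[OF S] s by auto
    moreover have "\<Prod>S \<ge> 1"
      using S by (metis less_one not_less prod_zero_iff)
    ultimately show P5 unfolding P5_def dvd_swap by blast
  qed
  moreover have "P4 \<longleftrightarrow> P7"
  proof -
    have "(\<forall>n. Ftr (n + p) R = Ftr n R) \<longleftrightarrow> Gfps R =
        (\<Sum>k<p. fps_const (of_int (Ftr k R)) * fps_X ^ k) / (1 - fps_X ^ p)" if "p > 0" for p
      using periodic_iff_fps[of "\<lambda>n. of_int (Ftr n R) :: rat" p] that
      \<comment> \<open>For \<open>p > 0\<close> the denominator has constant coefficient 1, so the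
        quotient is genuine.\<close>
      by (subst fps_eq_divide_iff) (simp_all add: Gfps_def)
    then show ?thesis unfolding P4_def P7_def by (auto simp: Suc_le_eq)
  qed
  ultimately show ?thesis by blast
qed

end
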